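(* Let $A\in\mathbb{C}^{n\times n}$, $b_0,b_1,\dots,b_s\in\mathbb{C}^n$ with $b_s\neq 0$, let $X\in\mathbb{C}^{ns\times s}$ be any full-rank matrix whose columns form a basis of $\mathcal K_s(J,\overline b)$, and let $W$, $Q_X$, $K_X$, $c_X$ be the associated matrices and vector defined in the context. Put $b=Q_Xc_X$. Then for any polynomial $p$, $$p(W)\,b = Q_X\,p(K_X)\,c_X .$$ In particular, for every $m\ge 1$, $$\mathcal K_m(W,b)=Q_X\,\mathcal K_m(K_X,c_X).$$
   Context: For a square matrix $M$ and a vector $v$, $\mathcal K_m(M,v)=\operatorname{span}\{v,Mv,\dots,M^{m-1}v\}$. Let $n,s\ge1$. $J_s(0)$ is the $s\times s$ Jordan block with eigenvalue zero (ones on the first superdiagonal, zeros elsewhere). Set $J=J_s(0)\otimes I_n\in\mathbb{C}^{ns\times ns}$ (Kronecker product), $E=[I_n,0,\dots,0]\in\mathbb{C}^{n\times ns}$, $$W=\begin{bmatrix}A&E\\0&J\end{bmatrix}\in\mathbb{C}^{(s+1)n\times(s+1)n},\qquad \overline b=[b_1^*,\dots,b_s^*]^*\in\mathbb{C}^{ns}.$$ Since $b_s\ne0$, $\dim\mathcal K_s(J,\overline b)=s$ and this space is $J$-invariant. For $X\in\mathbb{C}^{ns\times s}$ with columns forming a basis of $\mathcal K_s(J,\overline b)$, let $N\in\mathbb{C}^{s\times s}$ be the unique matrix with $JX=XN$ and let $\gamma\in\mathbb{C}^s$ be the unique vector with $\overline b=X\gamma$. Define $$K_X=\begin{bmatrix}A&EX\\0&N\end{bmatrix},\qquad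 c_X=\begin{bmatrix}b_0\\\gamma\end{bmatrix},\qquad Q_X=\begin{bmatrix}I_n&0\\0&X\end{bmatrix}.$$ Thus $Q_Xc_X=[b_0^*,\overline b^*]^*$. *)

theory Defs
  imports
    Complex_Main
    "HOL-Computational_Algebra.Polynomial"
    "Jordan_Normal_Form.Jordan_Normal_Form"
    "Jordan_Normal_Form.DL_Rank"
begin

(* The type of matrices has no zero element of its own, so the sum over the monomials
   is taken in the module of matrices of the size of M. *)
definition poly_mat :: "'a :: field poly \<Rightarrow> 'a mat \<Rightarrow> 'a mat" where
  "poly_mat p M =
     finsum (module_mat TYPE('a) (dim_row M) (dim_row M))
       (\<lambda>k. coeff p k \<cdot>\<^sub>m (M ^\<^sub>m k)) {..degree p}"

definition krylov :: "nat \<Rightarrow> 'a :: field mat \<Rightarrow> 'a vec \<Rightarrow> 'a vec set" where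
  "krylov m M v =
     LinearCombinations.module.span class_ring (module_vec TYPE('a) (dim_row M))
       ((\<lambda>k. (M ^\<^sub>m k) *\<^sub>v v) ` {..<m})"

(* Basis as an indexed family of columns: since "set" forgets repetitions,
   distinctness of the columns is required separately. *)
definition columns_form_basis :: "'a :: field mat \<Rightarrow> 'a vec set \<Rightarrow> bool" where
  "columns_form_basis X U \<longleftrightarrow>
     distinct (cols X) \<and>
     vectorspace.basis class_ring ((module_vec TYPE('a) (dim_row X))\<lparr>carrier := U\<rparr>)
       (set (cols X))"

definition kronecker :: "'a :: times mat \<Rightarrow> 'a mat \<Rightarrow> 'a mat" where
  "kronecker A B =
     mat (dim_row A * dim_row B) (dim_col A * dim_col B)
       (\<lambda>(i, j). A $$ (i div dim_row B, j div dim_col B) * B $$ (i mod dim_row B, j mod dim_col B))"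

definition J_mat :: "nat \<Rightarrow> nat \<Rightarrow> complex mat" where
  "J_mat n s = kronecker (jordan_block s 0) (1\<^sub>m n)"

definition E_mat :: "nat \<Rightarrow> nat \<Rightarrow> complex mat" where
  "E_mat n s = mat n (n * s) (\<lambda>(i, j). if i = j then 1 else 0)"

definition W_mat :: "nat \<Rightarrow> nat \<Rightarrow> complex mat \<Rightarrow> complex mat" where
  "W_mat n s A = four_block_mat A (E_mat n s) (0\<^sub>m (n * s) n) (J_mat n s)"

(* The vectors b 1, ..., b s of length n stacked on top of each other. *)
definition stacked :: "nat \<Rightarrow> nat \<Rightarrow> (nat \<Rightarrow> complex vec) \<Rightarrow> complex vec" where
  "stacked n s b = vec (n * s) (\<lambda>i. b (Suc (i div n)) $ (i mod n))"

(* The descriptions N_mat and gamma_vec determine an object when the columns of X form a basis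
   of the J-invariant space krylov s J bbar, where J = J_mat n s and bbar = stacked n s b. *)
definition N_mat :: "nat \<Rightarrow> nat \<Rightarrow> complex mat \<Rightarrow> complex mat" where
  "N_mat n s X = (THE N. N \<in> carrier_mat s s \<and> J_mat n s * X = X * N)"

definition gamma_vec :: "nat \<Rightarrow> nat \<Rightarrow> (nat \<Rightarrow> complex vec) \<Rightarrow> complex mat \<Rightarrow> complex vec" where
  "gamma_vec n s b X = (THE g. g \<in> carrier_vec s \<and> stacked n s b = X *\<^sub>v g)"

definition K_mat :: "nat \<Rightarrow> nat \<Rightarrow> complex mat \<Rightarrow> complex mat \<Rightarrow> complex mat" where
  "K_mat n s A X = four_block_mat A (E_mat n s * X) (0\<^sub>m s n) (N_mat n s X)"

definition c_vec :: "nat \<Rightarrow> nat \<Rightarrow> (nat \<Rightarrow> complex vec) \<Rightarrow> complex mat \<Rightarrow> complex vec" where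
  "c_vec n s b X = b 0 @\<^sub>v gamma_vec n s b X"

definition Q_mat :: "nat \<Rightarrow> nat \<Rightarrow> complex mat \<Rightarrow> complex mat" where
  "Q_mat n s X = four_block_mat (1\<^sub>m n) (0\<^sub>m n s) (0\<^sub>m (n * s) n) X"

end

theory Submission
  imports Defs
begin

text \<open>Since \<open>J\<^sup>s = 0\<close>, the Krylov space spanned by the columns of \<open>X\<close> is \<open>J\<close>-invariant, so
  \<open>N\<close> and \<open>\<gamma>\<close> exist; they are unique because \<open>X\<close> has independent columns. Then
  \<open>J X = X N\<close> gives \<open>W Q\<^sub>X = Q\<^sub>X K\<^sub>X\<close>, and \<open>Q\<^sub>X\<close> intertwines all powers,
  hence all polynomials, of \<open>W\<close> and \<open>K\<^sub>X\<close>. Linearity of \<open>Q\<^sub>X\<close> carries this over to spans.\<close>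

section \<open>Intertwining of powers and polynomials\<close>

text \<open>The factors \<open>W\<close> are moved past \<open>Q\<close> one at a time. Taking all
  three matrices equal shows that a matrix commutes with its powers, which
  \<open>krylov_invariant\<close> relies on.\<close>

lemma pow_mat_intertwine:
  fixes W Q K :: "'a :: semiring_1 mat"
  assumes W: "W \<in> carrier_mat r r" and K: "K \<in> carrier_mat c c" and Q: "Q \<in> carrier_mat r c"
    and WQ: "W * Q = Q * K"
  shows "W ^\<^sub>m k * Q = Q * K ^\<^sub>m k"
proof (induction k)
  case 0
  show ?case using assms by simp
next
  case (Suc k)
  have Wk: "W ^\<^sub>m k \<in> carrier_mat r r" and Kk: "K ^\<^sub>m k \<in> carrier_mat c c"
    using W K by auto
  have "W ^\<^sub>m Suc k * Q = W ^\<^sub>m k * (Q * K)"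
    using assoc_mult_mat[OF Wk W Q] WQ by simp
  also have "\<dots> = Q * K ^\<^sub>m k * K"
    using assoc_mult_mat[OF Wk Q K] Suc.IH by simp
  also have "\<dots> = Q * K ^\<^sub>m Suc k"
    using assoc_mult_mat[OF Q Kk K] by simp
  finally show ?case .
qed

lemma finsum_mat_carrier:
  fixes F :: "'b \<Rightarrow> 'a :: comm_ring_1 mat"
  assumes "\<And>k. k \<in> S \<Longrightarrow> F k \<in> carrier_mat r c"
  shows "finsum (module_mat TYPE('a) r c) F S \<in> carrier_mat r c"
proof -
  interpret abelian_group "module_mat TYPE('a) r c" by (rule abelian_group_mat)
  show ?thesis using finsum_closed[of F S] assms by (auto simp: module_mat_simps)
qed

text \<open>Distributivity on both sides carries the termwise relation over to sums. The two sums
  live in modules of matrices of different sizes, so the induction splits off one term in each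
  module separately.\<close>

lemma finsum_mat_intertwine:
  fixes F G :: "'b \<Rightarrow> 'a :: comm_ring_1 mat"
  assumes "finite S" and Q: "Q \<in> carrier_mat r c"
    and F: "\<And>k. k \<in> S \<Longrightarrow> F k \<in> carrier_mat r r"
    and G: "\<And>k. k \<in> S \<Longrightarrow> G k \<in> carrier_mat c c"
    and FG: "\<And>k. k \<in> S \<Longrightarrow> F k * Q = Q * G k"
  shows "finsum (module_mat TYPE('a) r r) F S * Q = Q * finsum (module_mat TYPE('a) c c) G S"
  using assms(1) F G FG
proof (induction S rule: finite_induct)
  case empty
  interpret r: abelian_group "module_mat TYPE('a) r r" by (rule abelian_group_mat)
  interpret c: abelian_group "module_mat TYPE('a) c c" by (rule abelian_group_mat)
  show ?case using Q by (simp add: module_mat_simps)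
next
  case (insert x S)
  interpret r: abelian_group "module_mat TYPE('a) r r" by (rule abelian_group_mat)
  interpret c: abelian_group "module_mat TYPE('a) c c" by (rule abelian_group_mat)
  have "finsum (module_mat TYPE('a) r r) F (insert x S) = F x + finsum (module_mat TYPE('a) r r) F S"
    using r.finsum_insert[OF insert.hyps, of F] insert.prems(1) by (auto simp: module_mat_simps)
  moreover have "finsum (module_mat TYPE('a) c c) G (insert x S) = G x + finsum (module_mat TYPE('a) c c) G S"
    using c.finsum_insert[OF insert.hyps, of G] insert.prems(2) by (auto simp: module_mat_simps)
  moreover have "finsum (module_mat TYPE('a) r r) F S \<in> carrier_mat r r"
    using insert.prems(1) by (intro finsum_mat_carrier) auto
  moreover have "finsum (module_mat TYPE('a) c c) G S \<in> carrier_mat c c"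
    using insert.prems(2) by (intro finsum_mat_carrier) auto
  ultimately show ?case
    using insert.IH insert.prems Q
    by (simp add: add_mult_distrib_mat[where nr = r and n = r and nc = c] mult_add_distrib_mat[where nr = r and n = c and nc = c])
qed

lemma poly_mat_carrier:
  "M \<in> carrier_mat r r \<Longrightarrow> poly_mat p M \<in> carrier_mat r r"
  unfolding poly_mat_def by (auto intro!: finsum_mat_carrier)

text \<open>Both sums run over the same exponents up to \<open>degree p\<close> with the same
  coefficients, so it suffices to intertwine each monomial.\<close>

lemma poly_mat_intertwine:
  fixes W Q K :: "'a :: field mat"
  assumes W: "W \<in> carrier_mat r r" and K: "K \<in> carrier_mat c c" and Q: "Q \<in> carrier_mat r c"
    and WQ: "W * Q = Q * K"
  shows "poly_mat p W * Q = Q * poly_mat p K"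
proof -
  have "(coeff p k \<cdot>\<^sub>m W ^\<^sub>m k) * Q = Q * (coeff p k \<cdot>\<^sub>m K ^\<^sub>m k)" for k
  proof -
    have Wk: "W ^\<^sub>m k \<in> carrier_mat r r" and Kk: "K ^\<^sub>m k \<in> carrier_mat c c"
      using W K by auto
    show ?thesis
      using mult_smult_assoc_mat[OF Wk Q] mult_smult_distrib[OF Q Kk] pow_mat_intertwine[OF assms]
      by simp
  qed
  then show ?thesis
    unfolding poly_mat_def carrier_matD(1)[OF W] carrier_matD(1)[OF K]
    using W K Q by (intro finsum_mat_intertwine) auto
qed

section \<open>Linear images of spans and Krylov spaces\<close>

text \<open>Both inclusions come from minimality of the span among submodules: one compares it with
  the image of a span, the other with the preimage of one.\<close>

lemma mult_mat_vec_image_span: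
  fixes M :: "'a :: field mat"
  assumes M: "M \<in> carrier_mat r c" and S: "S \<subseteq> carrier_vec c"
  shows "LinearCombinations.module.span class_ring (module_vec TYPE('a) r) ((*\<^sub>v) M ` S)
       = (*\<^sub>v) M ` LinearCombinations.module.span class_ring (module_vec TYPE('a) c) S"
proof -
  interpret r: vec_space "TYPE('a)" r .
  interpret c: vec_space "TYPE('a)" c .
  have M0: "M *\<^sub>v 0\<^sub>v c = 0\<^sub>v r" using M by (intro eq_vecI) auto
  have MS: "(*\<^sub>v) M ` S \<subseteq> carrier_vec r" using M S by auto
  have span_S: "c.span S \<subseteq> carrier_vec c"
    using c.span_is_subset2[of S] S by (simp add: module_vec_simps)
  have "submodule class_ring ((*\<^sub>v) M ` c.span S) r.V"
  proof (unfold_locales, goal_cases)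
    case 1
    then show ?case using M span_S by (auto simp: module_vec_simps)
  next
    case (2 v w)
    then obtain x y where "x \<in> c.span S" "y \<in> c.span S" "v = M *\<^sub>v x" "w = M *\<^sub>v y" by auto
    then show ?case
      using c.span_add1[of S x y] S span_S mult_add_distrib_mat_vec[OF M, of x y]
      by (auto simp: module_vec_simps subset_iff intro!: rev_image_eqI[of "x + y"])
  next
    case 3
    then show ?case
      using imageI[OF vectorspace.span_zero[OF c.vectorspace_axioms, of S], of "(*\<^sub>v) M"] M0
      by (simp add: module_vec_simps)
  next
    case (4 a v)
    then obtain x where x: "x \<in> c.span S" "v = M *\<^sub>v x" by auto
    have "a \<cdot>\<^sub>v v = M *\<^sub>v (a \<cdot>\<^sub>v x)"
      unfolding x(2) by (rule mult_mat_vec[OF M subsetD[OF span_S x(1)], symmetric])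
    then show ?case
      using imageI[OF c.smult_in_span[OF S x(1)], of "(*\<^sub>v) M" a] by (simp add: module_vec_simps)
  qed
  then have "r.span ((*\<^sub>v) M ` S) \<subseteq> (*\<^sub>v) M ` c.span S"
    using c.in_own_span[of S] S by (intro r.span_is_subset) (auto simp: module_vec_simps)
  \<comment> \<open>For the converse, the vectors that \<open>M\<close> sends into the span of the
    image form a submodule containing \<open>S\<close>, so they include all of its span.\<close>
  moreover have "submodule class_ring {x \<in> carrier_vec c. M *\<^sub>v x \<in> r.span ((*\<^sub>v) M ` S)} c.V"
  proof (unfold_locales, goal_cases)
    case 1
    then show ?case by (auto simp: module_vec_simps)
  next
    case (2 v w)
    then show ?case
      using r.span_add1[of "(*\<^sub>v) M ` S" "M *\<^sub>v v" "M *\<^sub>v w"] MS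
      by (auto simp: module_vec_simps mult_add_distrib_mat_vec[OF M])
  next
    case 3
    then show ?case using M0 vectorspace.span_zero[OF r.vectorspace_axioms, of "(*\<^sub>v) M ` S"] by (simp add: module_vec_simps)
  next
    case (4 a v)
    then show ?case
      using r.smult_in_span[OF MS, of "M *\<^sub>v v" a] by (auto simp: module_vec_simps mult_mat_vec[OF M])
  qed
  then have "c.span S \<subseteq> {x \<in> carrier_vec c. M *\<^sub>v x \<in> r.span ((*\<^sub>v) M ` S)}"
    using S r.in_own_span[of "(*\<^sub>v) M ` S"] MS
    by (intro c.span_is_subset) (auto simp: module_vec_simps)
  ultimately show ?thesis by auto
qed

text \<open>By \<open>pow_mat_intertwine\<close> the generators on the left are exactly the images
  under \<open>Q\<close> of the generators on the right; taking spans commutes with applying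
  \<open>Q\<close>.\<close>

lemma krylov_intertwine:
  fixes W Q K :: "'a :: field mat"
  assumes W: "W \<in> carrier_mat r r" and K: "K \<in> carrier_mat c c" and Q: "Q \<in> carrier_mat r c"
    and WQ: "W * Q = Q * K" and v: "v \<in> carrier_vec c"
  shows "krylov m W (Q *\<^sub>v v) = (*\<^sub>v) Q ` krylov m K v"
proof -
  have "W ^\<^sub>m k *\<^sub>v (Q *\<^sub>v v) = Q *\<^sub>v (K ^\<^sub>m k *\<^sub>v v)" for k
  proof -
    have Wk: "W ^\<^sub>m k \<in> carrier_mat r r" and Kk: "K ^\<^sub>m k \<in> carrier_mat c c"
      using W K by auto
    show ?thesis
      using assoc_mult_mat_vec[OF Wk Q v] assoc_mult_mat_vec[OF Q Kk v]
        pow_mat_intertwine[OF W K Q WQ, of k] by simp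
  qed
  then have "(\<lambda>k. W ^\<^sub>m k *\<^sub>v (Q *\<^sub>v v)) ` {..<m} = (*\<^sub>v) Q ` (\<lambda>k. K ^\<^sub>m k *\<^sub>v v) ` {..<m}"
    by (simp add: image_image)
  moreover have "(\<lambda>k. K ^\<^sub>m k *\<^sub>v v) ` {..<m} \<subseteq> carrier_vec c"
    using K v by (auto intro!: mult_mat_vec_carrier[of _ c c])
  ultimately show ?thesis
    unfolding krylov_def carrier_matD(1)[OF W] carrier_matD(1)[OF K]
    using mult_mat_vec_image_span[OF Q] by simp
qed

text \<open>\<open>M\<close> shifts each generator to the next one, and the last generator is sent
  to zero by \<open>nil\<close>, so no new direction appears.\<close>

lemma krylov_invariant:
  fixes M :: "'a :: field mat"
  assumes M: "M \<in> carrier_mat r r" and v: "v \<in> carrier_vec r" and nil: "M ^\<^sub>m m *\<^sub>v v = 0\<^sub>v r"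
    and x: "x \<in> krylov m M v"
  shows "M *\<^sub>v x \<in> krylov m M v"
proof -
  interpret vec_space "TYPE('a)" r .
  let ?S = "(\<lambda>k. M ^\<^sub>m k *\<^sub>v v) ` {..<m}"
  have S: "?S \<subseteq> carrier_vec r"
    using M v by (auto intro!: mult_mat_vec_carrier[of _ r r])
  have "M *\<^sub>v (M ^\<^sub>m k *\<^sub>v v) \<in> span ?S" if "k < m" for k
  proof -
    have Mk: "M ^\<^sub>m k \<in> carrier_mat r r" using M by auto
    \<comment> \<open>Powers grow by a factor on the right, so placing \<open>M\<close> on the left
      needs the commutation of \<open>M\<close> with its powers.\<close>
    have "M *\<^sub>v (M ^\<^sub>m k *\<^sub>v v) = M ^\<^sub>m Suc k *\<^sub>v v"
      using assoc_mult_mat_vec[OF M Mk v] pow_mat_intertwine[OF M M M refl, of k] by simp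
    moreover have "M ^\<^sub>m Suc k *\<^sub>v v \<in> span ?S"
    proof (cases "Suc k = m")
      case True
      then show ?thesis using nil vectorspace.span_zero[OF vectorspace_axioms, of ?S] by (simp add: module_vec_simps)
    next
      case False
      then have "M ^\<^sub>m Suc k *\<^sub>v v \<in> ?S" using that by (intro imageI) auto
      then show ?thesis using in_own_span[of ?S] S by (auto simp: module_vec_simps)
    qed
    ultimately show ?thesis by simp
  qed
  then have "(*\<^sub>v) M ` span ?S \<subseteq> span ?S"
    unfolding mult_mat_vec_image_span[OF M S, symmetric] by (intro span_subsetI[OF S]) auto
  then show ?thesis using x M unfolding krylov_def by auto
qed

section \<open>Coordinates with respect to the columns of a matrix\<close>

text \<open>A nonzero difference \<open>g - h\<close> would be a linear relation between the
  columns, against full rank. Distinctness lets its entries serve as coefficients on the set of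
  columns.\<close>

lemma full_rank_mult_mat_vec_inj:
  fixes X :: "'a :: field mat"
  assumes X: "X \<in> carrier_mat r c" and "distinct (cols X)" and "vec_space.rank r X = c"
    and g: "g \<in> carrier_vec c" and h: "h \<in> carrier_vec c" and eq: "X *\<^sub>v g = X *\<^sub>v h"
  shows "g = h"
proof -
  interpret vec_space "TYPE('a)" r .
  have "X *\<^sub>v (g - h) = 0\<^sub>v r"
    using X g h eq by (simp add: mult_minus_distrib_mat_vec)
  then have "g - h = 0\<^sub>v c"
    using lin_depI[OF X, of "g - h"] full_rank_lin_indpt[OF X] assms by auto
  then show ?thesis
    using g h by (metis add.right_neutral eq_iff_diff_eq_0 eq_vecI carrier_vecD index_minus_vec(1) index_zero_vec(1))
qed

lemma columns_form_basis_range: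
  fixes X :: "'a :: field mat"
  assumes X: "X \<in> carrier_mat r c" and S: "S \<subseteq> carrier_vec r"
    and U: "U = LinearCombinations.module.span class_ring (module_vec TYPE('a) r) S"
    and basis: "columns_form_basis X U"
  shows "U = (*\<^sub>v) X ` carrier_vec c"
proof -
  interpret vec_space "TYPE('a)" r .
  have dist: "distinct (cols X)" using basis by (simp add: columns_form_basis_def)
  have sub: "submodule class_ring U V"
    unfolding U using S by (intro span_is_submodule) (simp add: module_vec_simps)
  then have vs: "vectorspace class_ring (V\<lparr>carrier := U\<rparr>)"
    by (intro subspace_is_vs) (simp add: subspace_def vectorspace_axioms)
  have "vectorspace.basis class_ring (V\<lparr>carrier := U\<rparr>) (set (cols X))"
    using basis X by (simp add: columns_form_basis_def)
  then have "set (cols X) \<subseteq> U"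
    and "LinearCombinations.module.span class_ring (V\<lparr>carrier := U\<rparr>) (set (cols X)) = U"
    unfolding vectorspace.basis_def[OF vs] by auto
  \<comment> \<open>The basis property refers to the module with carrier cut down to
    \<open>U\<close>; for a submodule, spans formed there and in the ambient space agree.\<close>
  then have span_cols: "span (set (cols X)) = U"
    using span_li_not_depend(1)[OF _ sub] by simp
  have cols: "set (cols X) \<subseteq> carrier_vec r" using X cols_dim[of X] by simp
  show ?thesis
  proof (intro equalityI subsetI)
    fix v assume "v \<in> U"
    then obtain a where "v = lincomb a (set (cols X))"
      using finite_span[of "set (cols X)"] cols unfolding span_cols by (auto simp: module_vec_simps)
    then have "v = X *\<^sub>v vec c (\<lambda>i. a (col X i))"
      using mat_mult_eq_lincomb[OF X dist] by simp
    then show "v \<in> (*\<^sub>v) X ` carrier_vec c" by auto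
  next
    fix v assume "v \<in> (*\<^sub>v) X ` carrier_vec c"
    then obtain g where g: "g \<in> carrier_vec c" "v = X *\<^sub>v g" by auto
    \<comment> \<open>\<open>find_first\<close> recovers the index of a column, so each column
      receives its own entry of \<open>g\<close> as coefficient.\<close>
    then have "v = lincomb (\<lambda>a. g $ find_first a (cols X)) (set (cols X))"
      using lincomb_eq_mat_mult[OF X g(1) dist] by simp
    then show "v \<in> U" unfolding span_cols[symmetric] by (intro in_spanI) auto
  qed
qed

text \<open>The matrix equation is solved column by column; injectivity of \<open>X\<close> makes
  each column of the solution unique. This will justify the definite description of
  \<open>N\<close>.\<close>

lemma mat_factor_unique:
  fixes X Y :: "'a :: field mat"
  assumes X: "X \<in> carrier_mat r c" and Y: "Y \<in> carrier_mat r d"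
    and cols: "\<And>j. j < d \<Longrightarrow> col Y j \<in> (*\<^sub>v) X ` carrier_vec c"
    and inj: "\<And>g h. g \<in> carrier_vec c \<Longrightarrow> h \<in> carrier_vec c \<Longrightarrow> X *\<^sub>v g = X *\<^sub>v h \<Longrightarrow> g = h"
  shows "\<exists>!N. N \<in> carrier_mat c d \<and> Y = X * N"
proof (rule ex_ex1I)
  have "\<exists>g. \<forall>j<d. g j \<in> carrier_vec c \<and> col Y j = X *\<^sub>v g j"
    using cols by (intro choice) auto
  then obtain g where g: "\<And>j. j < d \<Longrightarrow> g j \<in> carrier_vec c"
    and Xg: "\<And>j. j < d \<Longrightarrow> col Y j = X *\<^sub>v g j" by blast
  define N where "N = mat_of_cols c (map g [0..<d])"
  have N: "N \<in> carrier_mat c d" by (simp add: N_def carrier_matI)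
  have "Y = X * N"
  proof (rule mat_col_eqI)
    fix j assume "j < dim_col (X * N)"
    then have j: "j < d" using N by simp
    then have "col N j = g j" using g by (simp add: N_def)
    then show "col Y j = col (X * N) j" using j Xg col_mult2[OF X N j] by simp
  qed (use X Y N in auto)
  then show "\<exists>N. N \<in> carrier_mat c d \<and> Y = X * N" using N by blast
next
  fix N N' assume "N \<in> carrier_mat c d \<and> Y = X * N" and "N' \<in> carrier_mat c d \<and> Y = X * N'"
  then have NC: "N \<in> carrier_mat c d" "N' \<in> carrier_mat c d" and eq: "X * N = X * N'" by auto
  show "N = N'"
  proof (rule mat_col_eqI)
    fix j assume "j < dim_col N'"
    then have j: "j < d" using NC by simp
    have "X *\<^sub>v col N j = X *\<^sub>v col N' j"
      using col_mult2[OF X NC(1) j] col_mult2[OF X NC(2) j] eq by simp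
    moreover have "col N j \<in> carrier_vec c" "col N' j \<in> carrier_vec c" using NC by auto
    ultimately show "col N j = col N' j" by (rule inj[rotated 2])
  qed (use NC in auto)
qed

section \<open>The block shift \<open>J\<close> and its nilpotency\<close>

lemma J_mat_carrier: "J_mat n s \<in> carrier_mat (n * s) (n * s)"
  unfolding J_mat_def kronecker_def by (simp add: carrier_matI mult.commute)

lemma J_mat_index:
  assumes "i < n * s" "j < n * s"
  shows "J_mat n s $$ (i, j) = (if j = i + n then 1 else 0)"
proof -
  have n: "n > 0" using assms by (cases n) auto
  \<comment> \<open>Quotient and remainder modulo \<open>n\<close> are the block number and the
    position inside a block: the Jordan block asks for consecutive blocks, the identity factor for
    equal positions.\<close>
  have "j = i + n \<longleftrightarrow> j div n = Suc (i div n) \<and> j mod n = i mod n"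
  proof
    assume *: "j div n = Suc (i div n) \<and> j mod n = i mod n"
    have "j = j div n * n + j mod n" by simp
    also have "\<dots> = i div n * n + i mod n + n" using * by simp
    finally show "j = i + n" by simp
  qed (use n in simp)
  moreover have "i div n < s" "j div n < s"
    using assms by (auto simp: less_mult_imp_div_less mult.commute)
  ultimately show ?thesis
    using assms n unfolding J_mat_def kronecker_def
    by (auto simp: jordan_block_def mult.commute)
qed

text \<open>\<open>J\<close> moves a stacked vector up by one block of length \<open>n\<close> and
  fills the last block with zeros.\<close>

lemma J_mat_mult_index:
  assumes v: "v \<in> carrier_vec (n * s)" and i: "i < n * s"
  shows "(J_mat n s *\<^sub>v v) $ i = (if i + n < n * s then v $ (i + n) else 0)"
proof -
  have "(J_mat n s *\<^sub>v v) $ i = (\<Sum>j = 0..<n * s. J_mat n s $$ (i, j) * v $ j)"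
    using v i J_mat_carrier[of n s] by (auto simp: scalar_prod_def)
  also have "\<dots> = (\<Sum>j = 0..<n * s. if j = i + n then v $ j else 0)"
    using i by (intro sum.cong) (auto simp: J_mat_index)
  finally show ?thesis by (simp add: sum.delta)
qed

lemma J_mat_pow_mult_index:
  assumes v: "v \<in> carrier_vec (n * s)" and i: "i < n * s"
  shows "(J_mat n s ^\<^sub>m k *\<^sub>v v) $ i = (if i + k * n < n * s then v $ (i + k * n) else 0)"
  using v
\<comment> \<open>The vector is generalised because the extra factor \<open>J\<close> acts first:
  the induction hypothesis is applied to \<open>J v\<close>.\<close>
proof (induction k arbitrary: v)
  case 0
  then show ?case using i J_mat_carrier[of n s] by simp
next
  case (Suc k)
  have J: "J_mat n s \<in> carrier_mat (n * s) (n * s)" by (rule J_mat_carrier)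
  then have Jk: "J_mat n s ^\<^sub>m k \<in> carrier_mat (n * s) (n * s)" by simp
  have Jv: "J_mat n s *\<^sub>v v \<in> carrier_vec (n * s)" using J Suc.prems by simp
  have "(J_mat n s ^\<^sub>m Suc k *\<^sub>v v) $ i = (J_mat n s ^\<^sub>m k *\<^sub>v (J_mat n s *\<^sub>v v)) $ i"
    using assoc_mult_mat_vec[OF Jk J Suc.prems] by simp
  then show ?case
    unfolding Suc.IH[OF Jv] using Suc.prems by (simp add: J_mat_mult_index algebra_simps)
qed

text \<open>After \<open>s\<close> shifts every index \<open>i + s * n\<close> lies beyond the end
  of the vector, so only zeros remain.\<close>

lemma J_mat_pow_eq_0:
  assumes "v \<in> carrier_vec (n * s)"
  shows "J_mat n s ^\<^sub>m s *\<^sub>v v = 0\<^sub>v (n * s)"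
proof (rule eq_vecI)
  fix i assume "i < dim_vec (0\<^sub>v (n * s))"
  then have i: "i < n * s" by simp
  then show "(J_mat n s ^\<^sub>m s *\<^sub>v v) $ i = 0\<^sub>v (n * s) $ i"
    unfolding J_mat_pow_mult_index[OF assms i] by (simp add: mult.commute)
qed (use J_mat_carrier[of n s] in simp)

section \<open>Existence of \<open>N\<close> and \<gamma>, and the block intertwining
  relation\<close>

theorem theorem3p2:
  fixes n s :: nat
    and A X :: "complex mat"
    and b :: "nat \<Rightarrow> complex vec"
  assumes "n \<ge> 1" and "s \<ge> 1"
    and "A \<in> carrier_mat n n"
    and "\<And>i. i \<le> s \<Longrightarrow> b i \<in> carrier_vec n"
    and "b s \<noteq> 0\<^sub>v n"
    and "X \<in> carrier_mat (n * s) s"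
    and "vec_space.rank (n * s) X = s"
    and "columns_form_basis X (krylov s (J_mat n s) (stacked n s b))"
  shows "(\<forall>p :: complex poly.
            poly_mat p (W_mat n s A) *\<^sub>v (Q_mat n s X *\<^sub>v c_vec n s b X)
              = Q_mat n s X *\<^sub>v (poly_mat p (K_mat n s A X) *\<^sub>v c_vec n s b X)) \<and>
         (\<forall>m \<ge> 1.
            krylov m (W_mat n s A) (Q_mat n s X *\<^sub>v c_vec n s b X)
              = (\<lambda>x. Q_mat n s X *\<^sub>v x) ` krylov m (K_mat n s A X) (c_vec n s b X))"
proof -
  let ?J = "J_mat n s" and ?b = "stacked n s b"
  let ?W = "W_mat n s A" and ?K = "K_mat n s A X" and ?Q = "Q_mat n s X" and ?c = "c_vec n s b X"
  note A = assms(3) and X = assms(6)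
  have J: "?J \<in> carrier_mat (n * s) (n * s)" by (rule J_mat_carrier)
  have E: "E_mat n s \<in> carrier_mat n (n * s)" by (simp add: E_mat_def)
  have b: "?b \<in> carrier_vec (n * s)" by (simp add: stacked_def)
  let ?S = "(\<lambda>k. ?J ^\<^sub>m k *\<^sub>v ?b) ` {..<s}"
  interpret vec_space "TYPE(complex)" "n * s" .
  have S: "?S \<subseteq> carrier_vec (n * s)"
    using J b by (auto intro!: mult_mat_vec_carrier[of _ "n * s" "n * s"])
  have krylov_eq: "krylov s ?J ?b = span ?S"
    using J by (simp add: krylov_def)
  have dist: "distinct (cols X)" using assms(8) by (simp add: columns_form_basis_def)
  note inj = full_rank_mult_mat_vec_inj[OF X dist assms(7)]
  have range: "krylov s ?J ?b = (*\<^sub>v) X ` carrier_vec s"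
    using columns_form_basis_range[OF X S krylov_eq assms(8)] .
  have "?b \<in> krylov s ?J ?b"
  proof -
    \<comment> \<open>The stacked vector is the generator with exponent zero, which is present since
      \<open>s\<close> is at least 1.\<close>
    have "?J ^\<^sub>m 0 *\<^sub>v ?b \<in> ?S" using assms(2) by (intro imageI) auto
    then show ?thesis
      using in_own_span[of ?S] S J b unfolding krylov_eq by (auto simp: module_vec_simps)
  qed
  then have "\<exists>!g. g \<in> carrier_vec s \<and> ?b = X *\<^sub>v g"
    unfolding range using inj by auto
  then have g: "gamma_vec n s b X \<in> carrier_vec s"
    unfolding gamma_vec_def by (rule theI'[THEN conjunct1])
  have "col (?J * X) j \<in> (*\<^sub>v) X ` carrier_vec s" if "j < s" for j
  proof -
    \<comment> \<open>A unit vector picks out a column of \<open>X\<close>, which places that column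
      in the Krylov space, where \<open>J\<close> may be applied without leaving it.\<close>
    have "X *\<^sub>v unit_vec s j \<in> krylov s ?J ?b" unfolding range by auto
    moreover have "X *\<^sub>v unit_vec s j = col X j" using X that by (intro eq_vecI) auto
    ultimately have "col X j \<in> krylov s ?J ?b" by simp
    then have "?J *\<^sub>v col X j \<in> krylov s ?J ?b"
      by (rule krylov_invariant[OF J b J_mat_pow_eq_0[OF b]])
    then show ?thesis using col_mult2[OF J X that] range by simp
  qed
  then have "\<exists>!N. N \<in> carrier_mat s s \<and> ?J * X = X * N"
    using J X inj by (intro mat_factor_unique[of X "n * s"]) auto
  from theI'[OF this] have N: "N_mat n s X \<in> carrier_mat s s" and JX: "?J * X = X * N_mat n s X"
    unfolding N_mat_def by auto
  have W: "?W \<in> carrier_mat (n + n * s) (n + n * s)"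
    unfolding W_mat_def using A J by auto
  have K: "?K \<in> carrier_mat (n + s) (n + s)"
    unfolding K_mat_def using A N by auto
  have Q: "?Q \<in> carrier_mat (n + n * s) (n + s)"
    unfolding Q_mat_def using X by auto
  have c: "?c \<in> carrier_vec (n + s)"
    unfolding c_vec_def using assms(4)[of 0] g by simp
  have EX: "E_mat n s * X \<in> carrier_mat n s" using E X by simp
  \<comment> \<open>Both block products have the same first block row and a zero lower left block;
    their lower right blocks are \<open>J X\<close> and \<open>X N\<close>, which agree by
    \<open>JX\<close>.\<close>
  have "?W * ?Q = four_block_mat A (E_mat n s * X) (0\<^sub>m (n * s) n) (?J * X)"
    unfolding W_mat_def Q_mat_def
    by (subst mult_four_block_mat[OF A E zero_carrier_mat J one_carrier_mat zero_carrier_mat zero_carrier_mat X])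
      (use A E J X EX in simp)
  also have "\<dots> = ?Q * ?K"
    unfolding K_mat_def Q_mat_def JX
    by (subst mult_four_block_mat[OF one_carrier_mat zero_carrier_mat zero_carrier_mat X A EX zero_carrier_mat N])
      (use A in \<open>simp add: left_mult_one_mat[OF EX] left_mult_zero_mat[OF EX] left_mult_zero_mat[OF N] right_mult_zero_mat[OF X] right_add_zero_mat[OF EX] left_add_zero_mat[OF mult_carrier_mat[OF X N]]\<close>)
  finally have WQ: "?W * ?Q = ?Q * ?K" .
  have "poly_mat p ?W *\<^sub>v (?Q *\<^sub>v ?c) = ?Q *\<^sub>v (poly_mat p ?K *\<^sub>v ?c)" for p
    using assoc_mult_mat_vec[OF poly_mat_carrier[OF W] Q c]
      assoc_mult_mat_vec[OF Q poly_mat_carrier[OF K] c] poly_mat_intertwine[OF W K Q WQ, of p]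
    by metis
  then show ?thesis using krylov_intertwine[OF W K Q WQ c] by blast
qed

end
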